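(* Let $A\in\mathbb{R}^{n\times n}$ and $c\in\mathbb{R}^{1\times n}$ be such that $(A,c)$ is observable. For $r\in\{1,\dots,n\}$ define $$\tilde A_r := A_{[r]},\qquad \tilde c_r := \left(\mathcal{O}^r\right)_{[r]},\qquad \tilde b_r := \left(A^{n-r}\left(\mathcal{O}^n\right)^{-1}\begin{pmatrix}0\\ I_r\end{pmatrix}\right)_{[r]}.$$ Then the observability operator $\mathcal{O}$ of $(A,c)$ is strictly $(n-1)$-variation bounding if and only if $(\tilde A_r,\tilde b_r,\tilde c_r)$ is strictly externally positive for all $r\in\{1,\dots,n\}$.
   Context: Observability: for $A\in\mathbb{R}^{n\times n}$, $c\in\mathbb{R}^{1\times n}$, the observability operator $\mathcal{O}=\mathcal{O}(A,c):\mathbb{R}^n\to\mathbb{R}^{\mathbb{Z}_{\ge 0}}$ is $(\mathcal{O}x_0)(t):=cA^tx_0$, $t\ge 0$. For $t\ge1$, $\mathcal{O}^t\in\mathbb{R}^{t\times n}$ is the matrix with rows $c, cA,\dots,cA^{t-1}$ (in this order). $(A,c)$ is observable if $\mathcal{O}^n$ is invertible. Compound matrices: for $X\in\mathbb{R}^{p\times q}$ and $1\le r\le\min\{p,q\}$, $X_{[r]}\in\mathbb{R}^{\binom{p}{r}\times\binom{q}{r}}$ is the $r$-th multiplicative compound matrix: its entries are the $r\times r$ minors $\det X_{I,J}$, where the row index sets $I\subset\{1,\dots,p\}$ and the column index sets $J\subset\{1,\dots,q\}$ of cardinality $r$ (listed increasingly) are ordered lexicographically. Strict external positivity: a triple $(\tilde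 A,\tilde b,\tilde c)$ (square matrix, column vector, row vector of compatible sizes) is strictly externally positive if $\tilde c\tilde A^{t-1}\tilde b>0$ for all integers $t\ge1$. Variation: for a real vector or sequence $u\neq0$, $S^-(u)$ is the number of sign changes in $u$ after deleting all zero entries, and $S^-(0):=-1$. $S^+(u)$ is the maximal number of sign changes obtainable after replacing each zero entry of $u$ by a nonzero real number. A linear map $u\mapsto Xu$ is strictly $k$-variation bounding ($k\in\mathbb{Z}_{\ge0}$) if $S^+(Xu)\le k$ for all $u\ne0$ with $S^-(u)\le k$. *)

theory Defs
  imports
    "Jordan_Normal_Form.Gauss_Jordan_Elimination"
    "Jordan_Normal_Form.Determinant"
    "Jordan_Normal_Form.DL_Submatrix"
    "HOL-Library.Extended_Real"
    "HOL-Library.List_Lexorder"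
begin

text \<open>Rows, columns and entries are indexed from 0. The row vector \<open>c\<close> is a \<open>1 \<times> n\<close> matrix.\<close>

definition observability_op :: "real mat \<Rightarrow> real mat \<Rightarrow> real vec \<Rightarrow> nat \<Rightarrow> real" where
  "observability_op A c x = (\<lambda>t. ((c * A ^\<^sub>m t) *\<^sub>v x) $ 0)"

definition observability_mat :: "real mat \<Rightarrow> real mat \<Rightarrow> nat \<Rightarrow> real mat" where
  "observability_mat A c t = mat t (dim_col A) (\<lambda>(i, j). (c * A ^\<^sub>m i) $$ (0, j))"

definition observable :: "real mat \<Rightarrow> real mat \<Rightarrow> bool" where
  "observable A c \<longleftrightarrow> invertible_mat (observability_mat A c (dim_row A))"

text \<open>An \<open>r\<close>-element index set is represented by the increasing list of its elements, so that the
  order on lists from \<^theory>\<open>HOL-Library.List_Lexorder\<close> is the lexicographic order.\<close>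

definition index_sets :: "nat \<Rightarrow> nat \<Rightarrow> nat list list" where
  "index_sets p r =
     sorted_list_of_set {xs. set xs \<subseteq> {..<p} \<and> length xs = r \<and> sorted_wrt (<) xs}"

definition compound_mat :: "nat \<Rightarrow> real mat \<Rightarrow> real mat" where
  "compound_mat r X =
     (let Is = index_sets (dim_row X) r; Js = index_sets (dim_col X) r
      in mat (length Is) (length Js)
           (\<lambda>(i, j). det (submatrix X (set (Is ! i)) (set (Js ! j)))))"

definition strictly_externally_positive :: "real mat \<Rightarrow> real mat \<Rightarrow> real mat \<Rightarrow> bool" where
  "strictly_externally_positive A b c \<longleftrightarrow>
     A \<in> carrier_mat (dim_row A) (dim_row A) \<and>
     b \<in> carrier_mat (dim_row A) 1 \<and>
     c \<in> carrier_mat 1 (dim_row A) \<and>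
     (\<forall>t::nat. t \<ge> 1 \<longrightarrow> (c * A ^\<^sub>m (t - 1) * b) $$ (0, 0) > 0)"

text \<open>A vector or sequence is given by its entries \<open>u i\<close> for \<open>i \<in> I\<close>, where \<open>I\<close> is \<open>{..<n}\<close> for
  vectors and \<open>UNIV\<close> for sequences. A sign change after deletion of the zero entries is a pair of
  nonzero entries of opposite sign with only zero entries in between.\<close>

definition sign_change_pairs :: "nat set \<Rightarrow> (nat \<Rightarrow> real) \<Rightarrow> (nat \<times> nat) set" where
  "sign_change_pairs I u =
     {(i, j). i \<in> I \<and> j \<in> I \<and> i < j \<and> u i * u j < 0 \<and>
        (\<forall>l \<in> I. i < l \<and> l < j \<longrightarrow> u l = 0)}"

definition sign_changes :: "nat set \<Rightarrow> (nat \<Rightarrow> real) \<Rightarrow> ereal" where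
  "sign_changes I u =
     (if finite (sign_change_pairs I u) then ereal (real (card (sign_change_pairs I u))) else \<infinity>)"

definition S_minus :: "nat set \<Rightarrow> (nat \<Rightarrow> real) \<Rightarrow> ereal" where
  "S_minus I u = (if \<forall>i\<in>I. u i = 0 then -1 else sign_changes I u)"

definition zero_replacements :: "nat set \<Rightarrow> (nat \<Rightarrow> real) \<Rightarrow> (nat \<Rightarrow> real) set" where
  "zero_replacements I u = {v. \<forall>i\<in>I. v i \<noteq> 0 \<and> (u i \<noteq> 0 \<longrightarrow> v i = u i)}"

text \<open>The maximum is attained when finite; it is \<open>\<infinity>\<close> if the numbers of sign changes are unbounded.\<close>

definition S_plus :: "nat set \<Rightarrow> (nat \<Rightarrow> real) \<Rightarrow> ereal" where
  "S_plus I u = (SUP v \<in> zero_replacements I u. sign_changes I v)"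

definition strictly_variation_bounding :: "nat \<Rightarrow> nat \<Rightarrow> (real vec \<Rightarrow> nat \<Rightarrow> real) \<Rightarrow> bool" where
  "strictly_variation_bounding k n X \<longleftrightarrow>
     (\<forall>u \<in> carrier_vec n. u \<noteq> 0\<^sub>v n \<and> S_minus {..<n} (\<lambda>i. u $ i) \<le> ereal (real k)
        \<longrightarrow> S_plus UNIV (X u) \<le> ereal (real k))"

definition compound_A :: "real mat \<Rightarrow> nat \<Rightarrow> real mat" where
  "compound_A A r = compound_mat r A"

definition compound_c :: "real mat \<Rightarrow> real mat \<Rightarrow> nat \<Rightarrow> real mat" where
  "compound_c A c r = compound_mat r (observability_mat A c r)"

text \<open>For an observable pair \<^const>\<open>mat_inverse\<close> returns \<open>Some\<close> of the inverse.\<close>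

definition compound_b :: "real mat \<Rightarrow> real mat \<Rightarrow> nat \<Rightarrow> real mat" where
  "compound_b A c r =
     (let n = dim_row A
      in compound_mat r
           (A ^\<^sub>m (n - r) * the (mat_inverse (observability_mat A c n)) *
            (0\<^sub>m (n - r) r @\<^sub>r 1\<^sub>m r)))"

end

theory Submission
  imports Defs
begin

text \<open>
  Since \<open>(A, c)\<close> is observable, every sequence \<open>\<O> u\<close> can be
  written as \<open>P x\<close>, where \<open>x = \<O>\<^sup>n u\<close> ranges over all of
  \<open>\<real>\<^sup>n\<close> and \<open>P = \<O> (\<O>\<^sup>n)\<inverse>\<close> is an
  infinite matrix whose first \<open>n\<close> rows form the identity. Both sides of the
  equivalence turn out to say that all \<open>n \<times> n\<close> minors of \<open>P\<close> are
  positive.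

  \<^bold>\<open>Variation.\<close> Every vector of length \<open>n\<close> has at most
  \<open>n - 1\<close> sign changes, so the left-hand side says that no \<open>P x\<close> with
  \<open>x \<noteq> 0\<close> weakly alternates in sign along \<open>n + 1\<close> indices
  (\<open>strictly_variation_bounding_iff\<close>). If it did, append the values of \<open>P
  x\<close> as a column to the corresponding \<open>(n + 1) \<times> n\<close> submatrix of
  \<open>P\<close> and expand the resulting singular determinant along this column: for positive
  minors all terms have the same sign, so they vanish, and \<open>x = 0\<close>
  (\<open>positive_minors_imp_not_weakly_alternating\<close>). Conversely, a minor with a row
  \<open>q + 1\<close>, but without row \<open>q\<close>, is positive if it is positive after
  replacing \<open>q + 1\<close> by \<open>q\<close>: letting the index of that one row vary gives
  a sequence \<open>P x\<close> that vanishes at the other \<open>n - 1\<close> indices, and a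
  positive value at \<open>q\<close> with a nonpositive one at \<open>q + 1\<close> would make it
  weakly alternate. Such replacements lead from any minor down to that of the identity
  (\<open>not_weakly_alternating_imp_positive_minors\<close>).

  \<^bold>\<open>External positivity.\<close> By the Cauchy-Binet formula compound matrices
  are multiplicative (\<open>compound_mat_mult\<close>), so the scalar that has to be positive is
  a single determinant. It is the minor of \<open>P\<close> with rows \<open>0, \<dots>, n - r -
  1\<close> followed by \<open>r\<close> consecutive rows \<open>s, \<dots>, s + r - 1\<close>,
  because expanding along the first \<open>n - r\<close> rows, which are unit vectors, leaves the
  last \<open>r\<close> columns (\<open>strictly_externally_positive_iff\<close>). That positivity
  of these special minors already forces positivity of all of them is a criterion in the style of
  Fekete (\<open>fekete_criterion\<close>), proved with the three-term Pluecker relation.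
\<close>

section \<open>The Cauchy-Binet formula and compound matrices\<close>

text \<open>The index sets of a compound matrix without their order: sums over minors do not depend on
  it.\<close>

definition increasing_lists :: "nat \<Rightarrow> nat \<Rightarrow> nat list set" where
  "increasing_lists p r = {xs. set xs \<subseteq> {..<p} \<and> length xs = r \<and> sorted_wrt (<) xs}"

lemma finite_increasing_lists [simp]: "finite (increasing_lists p r)"
  by (rule finite_subset[OF _ finite_lists_length_eq[of "{..<p}" r]])
    (auto simp: increasing_lists_def)

lemma permutes_of_same_range:
  assumes "distinct K" and "length K = r" and "inj_on f {0..<r}" and "f ` {0..<r} = set K"
  obtains p where "p permutes {0..<r}" and "\<And>i. i < r \<Longrightarrow> K ! p i = f i"
proof -
  have "\<exists>j. j < r \<and> K ! j = f i" if "i < r" for i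
    using assms(2,4) that by (metis atLeastLessThan_iff image_eqI in_set_conv_nth le0)
  then obtain q where q: "\<And>i. i < r \<Longrightarrow> q i < r \<and> K ! q i = f i" by metis
  define p where "p = (\<lambda>i. if i < r then q i else i)"
  have inj: "inj_on p {0..<r}"
    using assms(3) q unfolding inj_on_def p_def by (metis atLeastLessThan_iff)
  moreover have "p ` {0..<r} \<subseteq> {0..<r}" using q by (auto simp: p_def)
  ultimately have "bij_betw p {0..<r} {0..<r}"
    by (simp add: bij_betw_def endo_inj_surj)
  then have "p permutes {0..<r}"
    by (rule bij_imp_permutes) (auto simp: p_def)
  with q show ?thesis by (intro that[of p]) (auto simp: p_def)
qed

text \<open>Expanding the rows of \<open>X * Y\<close> as combinations of rows of \<open>Y\<close>
  gives a sum over all maps \<open>f\<close> from the row indices to \<open>{0..<m}\<close>. Maps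
  that are not injective contribute a determinant with two equal rows; an injective map is an
  increasing list \<open>K\<close> of its values followed by a permutation, and for fixed
  \<open>K\<close> the sum over the permutations is the Leibniz formula for the minor of
  \<open>X\<close>.\<close>

lemma cauchy_binet:
  fixes X Y :: "'a :: comm_ring_1 mat"
  assumes X: "X \<in> carrier_mat r m" and Y: "Y \<in> carrier_mat m r"
  shows "det (X * Y) = (\<Sum>K\<in>increasing_lists m r.
    det (mat r r (\<lambda>(i, j). X $$ (i, K ! j))) * det (mat r r (\<lambda>(i, j). Y $$ (K ! i, j))))"
proof -
  let ?U = "{0..<r}"
  let ?F = "{f. (\<forall>i\<in>?U. f i \<in> {0..<m}) \<and> (\<forall>i. i \<notin> ?U \<longrightarrow> f i = i)}"
  let ?I = "{f \<in> ?F. inj_on f ?U}"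
  let ?S = "increasing_lists m r \<times> {p. p permutes ?U}"
  define dY where "dY f = det (mat r r (\<lambda>(i, j). Y $$ (f i, j)))" for f :: "nat \<Rightarrow> nat"
  define g where "g f = (\<Prod>i\<in>?U. X $$ (i, f i)) * dY f" for f
  define h where "h = (\<lambda>(K, p) i. if i < r then K ! p i else (i::nat))"
  have fin: "finite ?F" by (rule finite_bounded_functions) auto
  have "det (X * Y) = det (mat\<^sub>r r r
      (\<lambda>i. finsum_vec TYPE('a) r (\<lambda>k. X $$ (i, k) \<cdot>\<^sub>v row Y k) {0..<m}))"
    using mat_mul_finsum_alt[OF X Y] by simp
  also have "\<dots> = (\<Sum>f\<in>?F. det (mat\<^sub>r r r (\<lambda>i. X $$ (i, f i) \<cdot>\<^sub>v row Y (f i))))"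
    by (rule det_linear_rows_sum) (use Y in auto)
  also have "\<dots> = sum g ?F"
  proof (rule sum.cong[OF refl])
    fix f assume f: "f \<in> ?F"
    have "mat\<^sub>r r r (\<lambda>i. row Y (f i)) = mat r r (\<lambda>(i, j). Y $$ (f i, j))"
      using f Y by (intro eq_matI) auto
    then show "det (mat\<^sub>r r r (\<lambda>i. X $$ (i, f i) \<cdot>\<^sub>v row Y (f i))) = g f"
      unfolding g_def dY_def
      by (subst det_rows_mul) (use f Y in auto)
  qed
  also have "\<dots> = sum g ?I"
  proof (rule sum.mono_neutral_right[OF fin])
    show "\<forall>f\<in>?F - ?I. g f = 0"
    proof
      fix f assume "f \<in> ?F - ?I"
      then obtain i j where ij: "i < r" "j < r" "i \<noteq> j" "f i = f j" by (auto simp: inj_on_def)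
      have "dY f = 0" unfolding dY_def
        by (rule det_identical_rows[of _ r i j]) (use ij in auto)
      then show "g f = 0" by (simp add: g_def)
    qed
  qed auto
  also have "\<dots> = sum (g \<circ> h) ?S"
  proof -
    have inj: "inj_on h ?S"
    proof (rule inj_onI, clarify)
      fix K p K' p'
      assume K: "K \<in> increasing_lists m r" and K': "K' \<in> increasing_lists m r"
        and p: "p permutes ?U" and p': "p' permutes ?U" and eq: "h (K, p) = h (K', p')"
      have e: "K ! p i = K' ! p' i" if "i < r" for i
        using fun_cong[OF eq, of i] that by (simp add: h_def)
      have im: "(\<lambda>i. L ! q i) ` ?U = set L"
        if "L \<in> increasing_lists m r" "q permutes ?U" for L q
      proof -
        have "(\<lambda>i. L ! q i) ` ?U = (!) L ` (q ` ?U)" by (simp add: image_image)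
        also have "\<dots> = (!) L ` {0..<length L}"
          using that by (simp add: permutes_image increasing_lists_def)
        also have "\<dots> = set L" by (auto simp: set_conv_nth)
        finally show ?thesis .
      qed
      have "set K = set K'"
        using im[OF K p] im[OF K' p'] e by (metis (no_types, lifting) atLeastLessThan_iff image_cong)
      then have KK: "K = K'"
        using K K' by (auto simp: increasing_lists_def strict_sorted_equal)
      have "p i = p' i" for i
      proof (cases "i < r")
        case True
        then have "p i < r" "p' i < r" using p p' permutes_in_image by fastforce+
        then show ?thesis using e[OF True] KK K
          by (auto simp: increasing_lists_def strict_sorted_iff nth_eq_iff_index_eq)
      next
        case False
        then show ?thesis using p p' by (simp add: permutes_def)
      qed
      with KK show "K = K' \<and> p = p'" by auto
    qed
    have "h ` ?S = ?I"
    proof (intro equalityI subsetI)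
      fix f assume "f \<in> h ` ?S"
      then obtain K p where K: "K \<in> increasing_lists m r" and p: "p permutes ?U" and f: "f = h (K, p)"
        by auto
      have pr: "p i < r" if "i < r" for i using p that permutes_in_image by fastforce
      have "f i < m" if "i < r" for i
        using K pr[OF that] that nth_mem by (fastforce simp: f h_def increasing_lists_def)
      moreover have "inj_on f ?U"
      proof (rule inj_onI)
        fix i j assume ij: "i \<in> ?U" "j \<in> ?U" "f i = f j"
        then have "K ! p i = K ! p j" by (simp add: f h_def)
        then have "p i = p j"
          using K pr ij(1,2) by (auto simp: increasing_lists_def strict_sorted_iff nth_eq_iff_index_eq)
        then show "i = j" using permutes_inj[OF p] by (simp add: inj_eq)
      qed
      ultimately show "f \<in> ?I" by (auto simp: f h_def)
    next
      fix f assume f: "f \<in> ?I"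
      define K where "K = sorted_list_of_set (f ` ?U)"
      have K: "K \<in> increasing_lists m r" "distinct K" "set K = f ` ?U" "length K = r"
        using f by (auto simp: K_def increasing_lists_def card_image)
      obtain p where p: "p permutes ?U" "\<And>i. i < r \<Longrightarrow> K ! p i = f i"
        using permutes_of_same_range[OF K(2,4)] f K(3) by (metis (no_types, lifting) mem_Collect_eq)
      have "f = h (K, p)"
        using f p(2) by (auto simp: h_def fun_eq_iff)
      then show "f \<in> h ` ?S" using K(1) p(1) by auto
    qed
    then show ?thesis using sum.reindex[OF inj, of g] by simp
  qed
  also have "\<dots> = (\<Sum>K\<in>increasing_lists m r. \<Sum>p | p permutes ?U. g (h (K, p)))"
    by (subst sum.cartesian_product) (auto intro: sum.cong)
  also have "\<dots> = (\<Sum>K\<in>increasing_lists m r.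
    det (mat r r (\<lambda>(i, j). X $$ (i, K ! j))) * det (mat r r (\<lambda>(i, j). Y $$ (K ! i, j))))"
  proof (rule sum.cong[OF refl])
    fix K assume K: "K \<in> increasing_lists m r"
    let ?X = "mat r r (\<lambda>(i, j). X $$ (i, K ! j))" and ?Y = "mat r r (\<lambda>(i, j). Y $$ (K ! i, j))"
    have "g (h (K, p)) = signof p * (\<Prod>i\<in>?U. ?X $$ (i, p i)) * det ?Y" if p: "p permutes ?U" for p
    proof -
      have pr: "p i < r" if "i < r" for i using p that permutes_in_image by fastforce
      have "dY (h (K, p)) = det (mat r r (\<lambda>(i, j). ?Y $$ (p i, j)))"
        unfolding dY_def by (rule arg_cong[of _ _ det], rule eq_matI) (auto simp: h_def pr)
      also have "\<dots> = signof p * det ?Y" by (rule det_permute_rows[OF _ p]) simp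
      finally have "dY (h (K, p)) = signof p * det ?Y" .
      moreover have "(\<Prod>i\<in>?U. X $$ (i, h (K, p) i)) = (\<Prod>i\<in>?U. ?X $$ (i, p i))"
        by (rule prod.cong) (auto simp: h_def pr)
      ultimately show ?thesis by (simp add: g_def mult_ac)
    qed
    then have "(\<Sum>p | p permutes ?U. g (h (K, p)))
        = (\<Sum>p | p permutes ?U. signof p * (\<Prod>i\<in>?U. ?X $$ (i, p i))) * det ?Y"
      by (simp add: sum_distrib_right)
    also have "\<dots> = det ?X * det ?Y" by (subst det_def'[of ?X r]) auto
    finally show "(\<Sum>p | p permutes ?U. g (h (K, p))) = det ?X * det ?Y" .
  qed
  finally show ?thesis .
qed

lemma set_index_sets [simp]: "set (index_sets p r) = increasing_lists p r"
  and distinct_index_sets [simp]: "distinct (index_sets p r)"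
  using finite_increasing_lists[of p r] by (simp_all add: index_sets_def increasing_lists_def)

lemma index_sets_nth: "i < length (index_sets p r) \<Longrightarrow> index_sets p r ! i \<in> increasing_lists p r"
  by (metis nth_mem set_index_sets)

lemma index_sets_full: "index_sets r r = [[0..<r]]"
proof -
  have "increasing_lists r r = {[0..<r]}"
  proof (intro equalityI subsetI)
    fix xs assume xs: "xs \<in> increasing_lists r r"
    then have sub: "set xs \<subseteq> {..<r}" and len: "length xs = r" and xs: "sorted_wrt (<) xs"
      by (auto simp: increasing_lists_def)
    have "card (set xs) = card {..<r}"
      using len xs by (simp add: strict_sorted_iff distinct_card)
    then have "set xs = set [0..<r]"
      using card_subset_eq[OF finite_lessThan sub] by (simp add: atLeast0LessThan)
    then have "xs = [0..<r]" using xs by (intro strict_sorted_equal) simp_all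
    then show "xs \<in> {[0..<r]}" by simp
  qed (auto simp: increasing_lists_def)
  then show ?thesis by (simp add: index_sets_def increasing_lists_def)
qed

lemma pick_increasing_list:
  assumes K: "sorted_wrt (<) K" and i: "i < length K"
  shows "pick (set K) i = K ! i"
proof -
  have mono: "K ! a < K ! b" if "a < b" "b < length K" for a b
    using K that by (simp add: sorted_wrt_iff_nth_less)
  have "{a \<in> set K. a < K ! i} = (!) K ` {..<i}"
  proof (intro equalityI subsetI)
    fix a assume "a \<in> {a \<in> set K. a < K ! i}"
    then obtain j where "j < length K" "a = K ! j" "K ! j < K ! i" by (auto simp: in_set_conv_nth)
    then show "a \<in> (!) K ` {..<i}" using mono[of i j] i
      by (metis image_eqI lessThan_iff linorder_neqE_nat order_less_asym order_less_irrefl)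
  qed (use i mono in auto)
  moreover have "inj_on ((!) K) {..<i}"
    using i K by (auto simp: inj_on_def strict_sorted_iff nth_eq_iff_index_eq)
  ultimately have "card {a \<in> set K. a < K ! i} = i" by (simp add: card_image)
  then show ?thesis using pick_card_in_set[of "K ! i" "set K"] i by simp
qed

lemma submatrix_increasing_lists:
  assumes "I \<in> increasing_lists (dim_row X) r" and "J \<in> increasing_lists (dim_col X) r"
  shows "submatrix X (set I) (set J) = mat r r (\<lambda>(i, j). X $$ (I ! i, J ! j))"
proof -
  have "card {i. i < m \<and> i \<in> set K} = r" if "K \<in> increasing_lists m r" for m K
  proof -
    have "{i. i < m \<and> i \<in> set K} = set K" using that by (auto simp: increasing_lists_def)
    then show ?thesis using that by (simp add: increasing_lists_def strict_sorted_iff distinct_card)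
  qed
  with assms show ?thesis unfolding submatrix_def
    by (intro eq_matI) (auto simp: increasing_lists_def pick_increasing_list)
qed

lemma dim_compound_mat [simp]:
  "dim_row (compound_mat r X) = length (index_sets (dim_row X) r)"
  "dim_col (compound_mat r X) = length (index_sets (dim_col X) r)"
  by (simp_all add: compound_mat_def Let_def)

lemma compound_mat_index:
  assumes "a < length (index_sets (dim_row X) r)" and "b < length (index_sets (dim_col X) r)"
  shows "compound_mat r X $$ (a, b) = det (mat r r (\<lambda>(i, j).
    X $$ (index_sets (dim_row X) r ! a ! i, index_sets (dim_col X) r ! b ! j)))"
proof -
  have "submatrix X (set (index_sets (dim_row X) r ! a)) (set (index_sets (dim_col X) r ! b))
      = mat r r (\<lambda>(i, j). X $$ (index_sets (dim_row X) r ! a ! i, index_sets (dim_col X) r ! b ! j))"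
    using assms by (intro submatrix_increasing_lists index_sets_nth)
  then show ?thesis using assms by (simp add: compound_mat_def Let_def)
qed

lemma compound_mat_full:
  assumes "X \<in> carrier_mat r r"
  shows "compound_mat r X = mat 1 1 (\<lambda>_. det X)"
proof -
  have "mat r r (\<lambda>(i, j). X $$ ([0..<r] ! i, [0..<r] ! j)) = X"
    using assms by (intro eq_matI) auto
  then show ?thesis
    using assms by (intro eq_matI) (auto simp: compound_mat_index index_sets_full)
qed

text \<open>Each entry of the product is the Cauchy-Binet formula for some rows of \<open>X\<close>
  and some columns of \<open>Y\<close>.\<close>

theorem compound_mat_mult:
  assumes X: "X \<in> carrier_mat p m" and Y: "Y \<in> carrier_mat m q"
  shows "compound_mat r (X * Y) = compound_mat r X * compound_mat r Y"
proof (rule eq_matI)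
  fix a b assume "a < dim_row (compound_mat r X * compound_mat r Y)"
    and "b < dim_col (compound_mat r X * compound_mat r Y)"
  then have a: "a < length (index_sets p r)" and b: "b < length (index_sets q r)"
    using X Y by auto
  define I where "I = index_sets p r ! a"
  define J where "J = index_sets q r ! b"
  define M where "M = index_sets m r"
  \<comment> \<open>the chosen rows of \<open>X\<close> with all columns, and the chosen columns of \<open>Y\<close> with all rows\<close>
  define XI where "XI = mat r m (\<lambda>(i, j). X $$ (I ! i, j))"
  define YJ where "YJ = mat m r (\<lambda>(i, j). Y $$ (i, J ! j))"
  have I: "I \<in> increasing_lists p r" and J: "J \<in> increasing_lists q r"
    using a b by (auto simp: I_def J_def index_sets_nth)
  have Ii: "I ! i < p" and Ji: "J ! i < q" if "i < r" for i
    using I J that by (auto simp: increasing_lists_def)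
      (metis lessThan_iff nth_mem subsetD)+
  have "mat r r (\<lambda>(i, j). (X * Y) $$ (I ! i, J ! j)) = XI * YJ"
    using X Y Ii Ji by (intro eq_matI) (auto simp: XI_def YJ_def scalar_prod_def)
  then have "compound_mat r (X * Y) $$ (a, b) = det (XI * YJ)"
    using X Y a b by (simp add: compound_mat_index I_def J_def)
  also have "\<dots> = (\<Sum>K\<in>increasing_lists m r. det (mat r r (\<lambda>(i, j). X $$ (I ! i, K ! j))) *
      det (mat r r (\<lambda>(i, j). Y $$ (K ! i, J ! j))))"
  proof (subst cauchy_binet[of XI r m YJ])
    have "mat r r (\<lambda>(i, j). XI $$ (i, K ! j)) = mat r r (\<lambda>(i, j). X $$ (I ! i, K ! j)) \<and>
      mat r r (\<lambda>(i, j). YJ $$ (K ! i, j)) = mat r r (\<lambda>(i, j). Y $$ (K ! i, J ! j))"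
      if "K \<in> increasing_lists m r" for K
    proof -
      have "K ! i < m" if "i < r" for i
        using \<open>K \<in> _\<close> that by (auto simp: increasing_lists_def) (metis lessThan_iff nth_mem subsetD)
      then show ?thesis by (auto simp: XI_def YJ_def intro!: eq_matI)
    qed
    then show "(\<Sum>K\<in>increasing_lists m r. det (mat r r (\<lambda>(i, j). XI $$ (i, K ! j))) *
        det (mat r r (\<lambda>(i, j). YJ $$ (K ! i, j)))) =
      (\<Sum>K\<in>increasing_lists m r. det (mat r r (\<lambda>(i, j). X $$ (I ! i, K ! j))) *
        det (mat r r (\<lambda>(i, j). Y $$ (K ! i, J ! j))))"
      by (intro sum.cong) auto
  qed (auto simp: XI_def YJ_def)
  also have "\<dots> = (\<Sum>l<length M. det (mat r r (\<lambda>(i, j). X $$ (I ! i, M ! l ! j))) *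
      det (mat r r (\<lambda>(i, j). Y $$ (M ! l ! i, J ! j))))"
    by (rule sum.reindex_bij_betw[symmetric])
      (use bij_betw_nth[of M "{..<length M}" "set M"] in \<open>auto simp: M_def\<close>)
  also have "\<dots> = (compound_mat r X * compound_mat r Y) $$ (a, b)"
    using X Y a b
    by (simp add: scalar_prod_def compound_mat_index I_def J_def M_def atLeast0LessThan)
  finally show "compound_mat r (X * Y) $$ (a, b) = (compound_mat r X * compound_mat r Y) $$ (a, b)" .
qed (use X Y in auto)

text \<open>Keeping a factor \<open>X\<close> on the left avoids the computation of the compound of an
  identity matrix, which the exponent \<open>0\<close> would otherwise need.\<close>

lemma compound_mat_mult_pow:
  assumes X: "X \<in> carrier_mat p n" and A: "A \<in> carrier_mat n n"
  shows "compound_mat r X * compound_mat r A ^\<^sub>m t = compound_mat r (X * A ^\<^sub>m t)"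
proof (induction t)
  case 0
  have "compound_mat r X \<in> carrier_mat (length (index_sets p r)) (length (index_sets n r))"
    using X by auto
  then show ?case using X A by simp
next
  case (Suc t)
  let ?N = "length (index_sets n r)"
  have c: "compound_mat r X \<in> carrier_mat (length (index_sets p r)) ?N"
    "compound_mat r A \<in> carrier_mat ?N ?N" using X A by auto
  have "compound_mat r X * compound_mat r A ^\<^sub>m Suc t
      = compound_mat r X * compound_mat r A ^\<^sub>m t * compound_mat r A"
    using assoc_mult_mat[OF c(1) pow_carrier_mat[OF c(2), of t] c(2)] by simp
  also have "\<dots> = compound_mat r (X * A ^\<^sub>m t * A)"
    using X A by (simp add: Suc compound_mat_mult[of _ p n _ n])
  also have "X * A ^\<^sub>m t * A = X * A ^\<^sub>m Suc t"
    using assoc_mult_mat[OF X pow_carrier_mat[OF A, of t] A] by simp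
  finally show ?case .
qed

section \<open>Relations between maximal minors\<close>

text \<open>The rows are given by a list, which need not be increasing, so that rows can be inserted,
  moved and repeated; the columns are the first \<open>length js\<close> ones, so that for
  \<open>n\<close> columns the maximal minors are those with \<open>length js = n\<close>.\<close>

definition rows_minor :: "(nat \<Rightarrow> nat \<Rightarrow> real) \<Rightarrow> nat list \<Rightarrow> real" where
  "rows_minor P js = det (mat (length js) (length js) (\<lambda>(i, j). P (js ! i) j))"

text \<open>Laplace expansion along the varying row: a minor as a function of one row index is itself
  a sequence in the column space of \<open>P\<close>. The coefficients \<open>x\<close> are the
  cofactors, which do not see this row.\<close>

lemma rows_minor_row_linear:
  obtains x where "\<And>i. rows_minor P (L @ i # R) = (\<Sum>j<Suc (length L + length R). P i j * x j)"
proof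
  let ?l = "length L" and ?n = "Suc (length L + length R)"
  define M where "M i = mat ?n ?n (\<lambda>(a, j). P ((L @ i # R) ! a) j)" for i
  have same: "mat_delete (M i) ?l j = mat_delete (M 0) ?l j" for i j
    by (rule eq_matI) (auto simp: M_def mat_delete_def nth_append nth_Cons')
  have entry: "M i $$ (?l, j) = P i j" if "j < ?n" for i j using that by (simp add: M_def)
  fix i
  have "rows_minor P (L @ i # R) = det (M i)" by (simp add: rows_minor_def M_def)
  also have "\<dots> = (\<Sum>j<?n. M i $$ (?l, j) * cofactor (M i) ?l j)"
    by (rule laplace_expansion_row) (auto simp: M_def)
  also have "\<dots> = (\<Sum>j<?n. P i j * cofactor (M 0) ?l j)"
    by (rule sum.cong) (simp_all add: cofactor_def same[of i] entry)
  finally show "rows_minor P (L @ i # R) = (\<Sum>j<?n. P i j * cofactor (M 0) ?l j)" .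
qed

lemma rows_minor_repeated_row:
  assumes "\<not> distinct js"
  shows "rows_minor P js = 0"
proof -
  obtain a b where ab: "a < length js" "b < length js" "a \<noteq> b" "js ! a = js ! b"
    using assms by (auto simp: distinct_conv_nth)
  show ?thesis unfolding rows_minor_def
    by (rule det_identical_rows[OF _ ab(3) ab(1,2)]) (use ab in auto)
qed

lemma rows_minor_swap: "rows_minor P (L @ i # j # R) = - rows_minor P (L @ j # i # R)"
proof -
  let ?n = "length L + Suc (Suc (length R))"
  let ?M = "\<lambda>js. mat ?n ?n (\<lambda>(a, b). P (js ! a) b)"
  have "?M (L @ i # j # R) = swaprows (length L) (Suc (length L)) (?M (L @ j # i # R))"
    by (rule eq_matI) (auto simp: nth_append nth_Cons')
  also have "det \<dots> = - det (?M (L @ j # i # R))"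
    by (rule det_swaprows[of _ ?n]) auto
  finally show ?thesis by (simp add: rows_minor_def)
qed

lemma rows_minor_move:
  "rows_minor P (L @ i # M @ R) = (-1) ^ length M * rows_minor P (L @ M @ i # R)"
proof (induction M arbitrary: L)
  case (Cons m M)
  show ?case
    using Cons[of "L @ [m]"] rows_minor_swap[of P L i m "M @ R"] by simp
qed simp

text \<open>Cramer's rule as a linear relation between \<open>n + 1\<close> rows of length
  \<open>n\<close>. Border the matrix of these rows by the column of the values \<open>y\<close>,
  a combination of its columns; the sum is the expansion of the resulting singular determinant
  along \<open>y\<close>.\<close>

lemma rows_minor_relation:
  assumes len: "length us = Suc n" and y: "\<And>i. y i = (\<Sum>j<n. P i j * x j)"
  shows "(\<Sum>k<Suc n. (-1) ^ k * y (us ! k) * rows_minor P (take k us @ drop (Suc k) us)) = 0"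
proof -
  define M where "M = mat (Suc n) (Suc n)
    (\<lambda>(i, j). case j of 0 \<Rightarrow> y (us ! i) | Suc j' \<Rightarrow> P (us ! i) j')"
  have M: "M \<in> carrier_mat (Suc n) (Suc n)" by (simp add: M_def)
  define w where "w = vec (Suc n) (\<lambda>j. case j of 0 \<Rightarrow> -1 | Suc j' \<Rightarrow> x j')"
  have "M *\<^sub>v w = 0\<^sub>v (Suc n)"
  proof (rule eq_vecI)
    fix i assume "i < dim_vec (0\<^sub>v (Suc n) :: real vec)"
    then show "(M *\<^sub>v w) $ i = 0\<^sub>v (Suc n) $ i"
      by (simp add: M_def w_def scalar_prod_def y atLeast0LessThan sum.lessThan_Suc_shift
          del: sum.lessThan_Suc sum.op_ivl_Suc)
  qed (simp add: M_def)
  moreover have "w \<in> carrier_vec (Suc n)" "w $ 0 = -1" by (simp_all add: w_def)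
  then have "w \<in> carrier_vec (Suc n)" "w \<noteq> 0\<^sub>v (Suc n)" by auto
  ultimately have "det M = 0" using det_0_iff_vec_prod_zero_field[OF M] by blast
  moreover have "det M = (\<Sum>k<Suc n. M $$ (k, 0) * cofactor M k 0)"
    by (rule laplace_expansion_column[OF M]) simp
  moreover have "M $$ (k, 0) * cofactor M k 0
      = (-1) ^ k * y (us ! k) * rows_minor P (take k us @ drop (Suc k) us)" if k: "k < Suc n" for k
  proof -
    have "mat_delete M k 0 = mat n n (\<lambda>(i, j). P ((take k us @ drop (Suc k) us) ! i) j)"
      by (rule eq_matI) (use k len in \<open>auto simp: M_def mat_delete_def nth_append min_def\<close>)
    moreover have "length (take k us @ drop (Suc k) us) = n" using k len by simp
    ultimately have "det (mat_delete M k 0) = rows_minor P (take k us @ drop (Suc k) us)"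
      by (simp only: rows_minor_def)
    then show ?thesis using k by (simp add: M_def cofactor_def)
  qed
  ultimately show ?thesis by simp
qed

text \<open>For increasing rows \<open>a < b < c < d\<close> this is \<open>[ac] [bd] = [ab] [cd] +
  [ad] [bc]\<close>, where the rows in \<open>T\<close>, \<open>S\<close>, \<open>S'\<close> are
  common to all minors. All six lists are written in the order that is increasing in the
  application below, so no signs occur. It is the linear relation between the rows \<open>T, b, S,
  c, S', d\<close> for the sequence \<open>y i = [a i]\<close>, which vanishes at the rows of
  \<open>T\<close>, \<open>S\<close>, \<open>S'\<close>.\<close>

lemma three_term_pluecker:
  "rows_minor P (T @ a # S @ c # S') * rows_minor P (T @ b # S @ S' @ [d])
    = rows_minor P (T @ a # b # S @ S') * rows_minor P (T @ S @ c # S' @ [d])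
    + rows_minor P (T @ a # S @ S' @ [d]) * rows_minor P (T @ b # S @ c # S')"
proof -
  let ?t = "length T" and ?s = "length S" and ?s' = "length S'"
  let ?D = "rows_minor P"
  define n where "n = ?t + ?s + ?s' + 2"
  define us where "us = T @ b # S @ c # S' @ [d]"
  define y where "y i = ?D (T @ a # i # S @ S')" for i
  obtain x where "y i = (\<Sum>j<n. P i j * x j)" for i
    by (rule rows_minor_row_linear[of P "T @ [a]" "S @ S'"]) (auto simp: y_def n_def add_ac)
  define f where "f k = (-1) ^ k * y (us ! k) * ?D (take k us @ drop (Suc k) us)" for k
  have len: "length us = Suc n" by (simp add: us_def n_def)
  have "(\<Sum>k<Suc n. f k) = 0"
    unfolding f_def by (rule rows_minor_relation[OF len]) fact
  \<comment> \<open>only the terms at the positions of \<open>b\<close>, \<open>c\<close> and \<open>d\<close> survive\<close>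
  also have "(\<Sum>k<Suc n. f k) = (\<Sum>k\<in>{?t, Suc (?t + ?s), n}. f k)"
  proof (rule sum.mono_neutral_right)
    show "\<forall>k\<in>{..<Suc n} - {?t, Suc (?t + ?s), n}. f k = 0"
    proof
      fix k assume k: "k \<in> {..<Suc n} - {?t, Suc (?t + ?s), n}"
      then consider "k < ?t" | "?t < k" "k < Suc (?t + ?s)" | "Suc (?t + ?s) < k" "k < n" by force
      then have "us ! k \<in> set T \<union> set S \<union> set S'"
        by cases (auto simp: us_def n_def nth_append nth_Cons')
      then have "y (us ! k) = 0"
        unfolding y_def by (intro rows_minor_repeated_row) auto
      then show "f k = 0" by (simp add: f_def)
    qed
  qed (auto simp: n_def)
  also have "\<dots> = f ?t + f (Suc (?t + ?s)) + f n" by (simp add: n_def)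
  finally have "f ?t + f (Suc (?t + ?s)) + f n = 0" .
  moreover have "f (length A) = (-1) ^ length A * y i * ?D (A @ B)" if "us = A @ i # B" for A i B
    using that by (simp add: f_def)
  from this[of T b "S @ c # S' @ [d]"] this[of "T @ b # S" c "S' @ [d]"] this[of "T @ b # S @ c # S'" d "[]"]
  have "f ?t = (-1) ^ ?t * (y b * ?D (T @ S @ c # S' @ [d]))"
    "f (Suc (?t + ?s)) = (-1) ^ Suc (?t + ?s) * (y c * ?D (T @ b # S @ S' @ [d]))"
    "f n = (-1) ^ n * (y d * ?D (T @ b # S @ c # S'))"
    by (simp_all add: us_def n_def add_ac)
  moreover have "y b = ?D (T @ a # b # S @ S')" by (simp add: y_def)
  moreover have "y c = (-1) ^ ?s * ?D (T @ a # S @ c # S')"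
    using rows_minor_move[of P "T @ [a]" c S S'] by (simp add: y_def)
  moreover have "y d = (-1) ^ (?s + ?s') * ?D (T @ a # S @ S' @ [d])"
    using rows_minor_move[of P "T @ [a]" d "S @ S'" "[]"] by (simp add: y_def)
  ultimately have "(-1) ^ ?t * (?D (T @ a # b # S @ S') * ?D (T @ S @ c # S' @ [d])
      - (-1) ^ (?s + ?s) * ?D (T @ a # S @ c # S') * ?D (T @ b # S @ S' @ [d])
      + (-1) ^ ((?s + ?s') + (?s + ?s')) * ?D (T @ a # S @ S' @ [d]) * ?D (T @ b # S @ c # S')) = 0"
    by (simp only: n_def power_add power_Suc) (simp add: algebra_simps)
  moreover have "(-1 :: real) ^ (m + m) = 1" for m by (simp add: minus_one_power_iff)
  ultimately show ?thesis by simp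
qed

section \<open>A Fekete criterion for positive maximal minors\<close>

lemma sorted_split_at:
  fixes J :: "'a :: linorder list"
  assumes "sorted_wrt (<) J" and "p \<notin> set J"
  obtains S S' where "J = S @ S'" and "\<forall>j\<in>set S. j < p" and "\<forall>j\<in>set S'. p < j"
proof -
  have "\<exists>S S'. J = S @ S' \<and> (\<forall>j\<in>set S. j < p) \<and> (\<forall>j\<in>set S'. p < j)"
    using assms
  proof (induction J)
    case (Cons a J)
    then obtain S S' where S: "J = S @ S'" "\<forall>j\<in>set S. j < p" "\<forall>j\<in>set S'. p < j" by auto
    show ?case
    proof (cases "a < p")
      case True
      then show ?thesis using S by (intro exI[of _ "a # S"] exI[of _ S']) auto
    next
      case False
      then have "p < a" using Cons.prems by auto
      then show ?thesis using Cons.prems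
        by (intro exI[of _ "[]"] exI[of _ "a # J"]) auto
    qed
  qed simp
  with that show ?thesis by blast
qed

text \<open>The minors with rows \<open>0, \<dots>, k - 1\<close> and \<open>n - k\<close> further
  rows \<open>J\<close> are shown to be positive for \<open>k\<close> descending from
  \<open>n\<close> to \<open>0\<close>. For fixed \<open>k\<close>, induct on the width of a
  window containing \<open>J\<close>. If \<open>k\<close> is in \<open>J\<close>, the case
  \<open>k + 1\<close> applies; if \<open>J\<close> fills the window, it is consecutive and the
  hypothesis applies. Otherwise there is a row \<open>p\<close> missing between the ends
  \<open>b\<close> and \<open>d\<close> of \<open>J\<close>, and the three-term relation for the
  rows \<open>k < b < p < d\<close> expresses \<open>[bd]\<close> through minors containing row
  \<open>k\<close> and through \<open>[pd]\<close> and \<open>[bp]\<close>, whose further rows lie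
  in narrower windows.\<close>

theorem fekete_criterion:
  assumes init: "\<And>k s. k \<le> n \<Longrightarrow> k \<le> s \<Longrightarrow> rows_minor P ([0..<k] @ [s..<s + (n - k)]) > 0"
    and J: "sorted_wrt (<) J" "length J = n"
  shows "rows_minor P J > 0"
proof -
  have "\<forall>J. sorted_wrt (<) J \<longrightarrow> length J = n - k \<longrightarrow> (\<forall>j\<in>set J. k \<le> j)
      \<longrightarrow> rows_minor P ([0..<k] @ J) > 0" if "k \<le> n" for k
    using that
  proof (induction k rule: inc_induct)
    case base
    then show ?case using init[of n n] by simp
  next
    case (step k)
    have IH: "rows_minor P ([0..<k] @ k # J) > 0"
      if "sorted_wrt (<) J" "Suc (length J) = n - k" "\<forall>j\<in>set J. k < j" for J
    proof -
      have "rows_minor P ([0..<Suc k] @ J) > 0"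
        using step.IH that by (intro step.IH[rule_format]) auto
      then show ?thesis by simp
    qed
    have window: "rows_minor P ([0..<k] @ J) > 0"
      if "sorted_wrt (<) J" "length J = n - k" "k \<le> a" "set J \<subseteq> {a..<a + d}" for J a d
      using that
    proof (induction d arbitrary: a J)
      case 0
      then show ?case using step.hyps by simp
    next
      case (Suc d)
      show ?case
      proof (cases "a \<in> set J \<and> a + d \<in> set J")
        case False
        then consider "set J \<subseteq> {Suc a..<Suc a + d}" | "set J \<subseteq> {a..<a + d}"
          using Suc.prems(4) by (force simp: less_Suc_eq le_eq_less_or_eq)
        then show ?thesis
        proof cases
          case 1
          then show ?thesis using Suc.IH[of J "Suc a"] Suc.prems by simp
        next
          case 2
          then show ?thesis using Suc.IH[of J a] Suc.prems by simp
        qed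
      next
        case ends: True
        show ?thesis
        proof (cases "{a..<a + Suc d} \<subseteq> set J")
          case True
          then have "set J = {a..<a + Suc d}" using Suc.prems(4) by auto
          then have "J = [a..<a + Suc d]"
            using Suc.prems(1) by (intro strict_sorted_equal) (simp_all del: upt_Suc)
          moreover from this have "Suc d = n - k" using Suc.prems(2) by simp
          ultimately show ?thesis using init[of k a] Suc.prems(3) step.hyps by simp
        next
          case False
          then obtain p where p: "a \<le> p" "p \<le> a + d" "p \<notin> set J" by fastforce
          then have pa: "a < p" "p < a + d" using ends by (auto simp: le_less)
          obtain U U' where U: "J = U @ U'" "\<forall>j\<in>set U. j < p" "\<forall>j\<in>set U'. p < j"
            using sorted_split_at[OF Suc.prems(1) p(3)] .
          have "a \<in> set U" using ends U pa by auto
          then obtain u S where uS: "U = u # S" by (cases U) auto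
          have "a + d \<in> set U'" using ends U pa by auto
          then obtain S' v where vS: "U' = S' @ [v]" by (cases U' rule: rev_cases) auto
          have J: "J = u # S @ S' @ [v]" using U uS vS by simp
          have range: "a \<le> j \<and> j \<le> a + d" if "j \<in> set J" for j
            using subsetD[OF Suc.prems(4) that] by simp
          have "a \<le> u" "v \<le> a + d" using range[of u] range[of v] by (simp_all add: J)
          moreover have "\<forall>j\<in>set J. u \<le> j \<and> j \<le> v"
            using Suc.prems(1) unfolding J by (auto simp: sorted_wrt_append intro: less_imp_le)
          then have "u \<le> a" "a + d \<le> v" using ends by blast+
          ultimately have J: "J = a # S @ S' @ [a + d]" using J by simp
          have Sp: "\<forall>j\<in>set S. j < p" "\<forall>j\<in>set S'. p < j" using U uS vS by auto
          have sorted: "sorted_wrt (<) (a # S @ S' @ [a + d])" and len: "length (a # S @ S' @ [a + d]) = n - k"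
            using Suc.prems J by auto
          show ?thesis
          proof (cases "a = k")
            case True
            then show ?thesis unfolding J using IH[of "S @ S' @ [a + d]"] sorted len by auto
          next
            case False
            then have "k < a" using Suc.prems(3) by simp
            have S: "sorted_wrt (<) S" "sorted_wrt (<) S'" "\<forall>x\<in>set S. \<forall>y\<in>set S'. x < y"
              and inner: "\<forall>j\<in>set S \<union> set S'. a < j \<and> j < a + d"
              and len: "length S + length S' + 2 = n - k"
              using sorted len by (auto simp: sorted_wrt_append)
            have range: "\<forall>j\<in>set S \<union> set S'. k < j \<and> a < j \<and> j < a + d"
              using inner \<open>k < a\<close> order.strict_trans by blast
            have "\<forall>j\<in>set S \<union> set S'. Suc a \<le> j \<and> a \<le> j \<and> j < Suc (a + d)"
              using inner by (meson Suc_leI less_SucI less_imp_le)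
            note facts = this S range len Sp pa \<open>k < a\<close>
            have "rows_minor P ([0..<k] @ k # S @ p # S') > 0"
              by (rule IH) (use facts in \<open>auto simp: sorted_wrt_append\<close>)
            moreover have "rows_minor P ([0..<k] @ k # a # S @ S') > 0"
              by (rule IH) (use facts in \<open>auto simp: sorted_wrt_append\<close>)
            moreover have "rows_minor P ([0..<k] @ k # S @ S' @ [a + d]) > 0"
              by (rule IH) (use facts in \<open>auto simp: sorted_wrt_append\<close>)
            moreover have "rows_minor P ([0..<k] @ S @ p # S' @ [a + d]) > 0"
              by (rule Suc.IH[of _ "Suc a"])
                (use facts in \<open>auto simp: sorted_wrt_append\<close>)
            moreover have "rows_minor P ([0..<k] @ a # S @ p # S') > 0"
              by (rule Suc.IH[of _ a])
                (use facts in \<open>auto simp: sorted_wrt_append\<close>)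
            ultimately have "rows_minor P ([0..<k] @ k # S @ p # S') * rows_minor P ([0..<k] @ J) > 0"
              unfolding J three_term_pluecker[of P "[0..<k]" k S p S' a "a + d"]
              by (simp add: add_pos_pos)
            with \<open>rows_minor P ([0..<k] @ k # S @ p # S') > 0\<close> show ?thesis
              by (simp add: zero_less_mult_iff)
          qed
        qed
      qed
    qed
    show ?case
    proof (intro allI impI)
      fix J assume J: "sorted_wrt (<) J" "length J = n - k" "\<forall>j\<in>set J. k \<le> j"
      obtain b where "set J \<subseteq> {..<b}" using finite_nat_bounded[of "set J"] by auto
      then have "set J \<subseteq> {k..<k + b}" using J(3) by fastforce
      then show "rows_minor P ([0..<k] @ J) > 0" using window[of J k b] J by simp
    qed
  qed
  from this[of 0] J show ?thesis by simp
qed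

section \<open>Sign changes of sequences\<close>

text \<open>Zeros may be given either sign: this is what makes the notion match
  \<^const>\<open>S_plus\<close>.\<close>

definition weakly_alternating :: "(nat \<Rightarrow> real) \<Rightarrow> nat list \<Rightarrow> bool" where
  "weakly_alternating y us \<longleftrightarrow>
     (\<exists>e. (e = 1 \<or> e = -1) \<and> (\<forall>k<length us. e * (-1) ^ k * y (us ! k) \<ge> 0))"

lemma sign_change_between:
  fixes v :: "nat \<Rightarrow> real"
  assumes "i < j" and "v i * v j < 0" and nz: "\<And>l. v l \<noteq> 0"
  shows "\<exists>l\<in>{i..<j}. v l * v (Suc l) < 0"
proof (rule ccontr)
  assume "\<not> ?thesis"
  then have pos: "v l * v (Suc l) > 0" if "i \<le> l" "l < j" for l
    using that nz[of l] nz[of "Suc l"] by (metis atLeastLessThan_iff linorder_neqE_linordered_idom mult_eq_0_iff)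
  have "v i * v l > 0" if "i \<le> l" "l \<le> j" for l
    using that
  proof (induction l rule: dec_induct)
    case base
    then show ?case using nz[of i] by (simp add: zero_less_mult_iff) linarith
  next
    case (step l)
    then show ?case using pos[of l] by (auto simp: zero_less_mult_iff)
  qed
  from this[of j] assms(1,2) show False by simp
qed

text \<open>Reading a nowhere zero sequence from left to right, one collects an index after each sign
  change. The invariant that the last collected value has the sign of the current one makes the
  next sign change extend the alternation.\<close>

lemma alternating_prefix:
  fixes v :: "nat \<Rightarrow> real"
  assumes nz: "\<And>l. v l \<noteq> 0"
  shows "\<exists>us e. (e = 1 \<or> e = -1) \<and> sorted_wrt (<) us \<and> set us \<subseteq> {..N} \<and>
    length us = Suc (card {l. l < N \<and> v l * v (Suc l) < 0}) \<and>
    (\<forall>k<length us. e * (-1) ^ k * v (us ! k) > 0) \<and> v (last us) * v N > 0"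
proof (induction N)
  case 0
  show ?case
    using nz[of 0] by (intro exI[of _ "[0]"] exI[of _ "sgn (v 0)"]) (auto simp: sgn_if zero_less_mult_iff)
next
  case (Suc N)
  then obtain us e where us: "e = 1 \<or> e = -1" "sorted_wrt (<) us" "set us \<subseteq> {..N}"
    "length us = Suc (card {l. l < N \<and> v l * v (Suc l) < 0})"
    "\<And>k. k < length us \<Longrightarrow> e * (-1) ^ k * v (us ! k) > 0" "v (last us) * v N > 0"
    by blast
  show ?case
  proof (cases "v N * v (Suc N) < 0")
    case True
    have "{l. l < Suc N \<and> v l * v (Suc l) < 0} = insert N {l. l < N \<and> v l * v (Suc l) < 0}"
      using True by (auto simp: less_Suc_eq)
    then have len: "length (us @ [Suc N]) = Suc (card {l. l < Suc N \<and> v l * v (Suc l) < 0})"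
      using us(4) by simp
    have "us \<noteq> []" using us(4) by auto
    then have "e * (-1) ^ (length us - 1) * v (last us) > 0"
      using us(5)[of "length us - 1"] by (simp add: last_conv_nth)
    moreover have "v (last us) * v (Suc N) < 0"
      using us(6) True by (auto simp: zero_less_mult_iff mult_less_0_iff)
    moreover have "(-1 :: real) ^ length us = - ((-1) ^ (length us - 1))"
      using \<open>us \<noteq> []\<close> by (cases us) auto
    ultimately have "e * (-1) ^ length us * v (Suc N) > 0"
      by (auto simp: zero_less_mult_iff mult_less_0_iff)
    then have "\<forall>k<length (us @ [Suc N]). e * (-1) ^ k * v ((us @ [Suc N]) ! k) > 0"
      using us(5) by (auto simp: nth_append less_Suc_eq)
    then show ?thesis
      using us(1-3) len nz[of "Suc N"]
      by (intro exI[of _ "us @ [Suc N]"] exI[of _ e])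
        (fastforce simp: sorted_wrt_append zero_less_mult_iff)
  next
    case False
    then have "v N * v (Suc N) > 0" using nz[of N] nz[of "Suc N"]
      by (metis linorder_neqE_linordered_idom mult_eq_0_iff)
    then have "v (last us) * v (Suc N) > 0" using us(6) by (auto simp: zero_less_mult_iff)
    moreover have "{l. l < Suc N \<and> v l * v (Suc l) < 0} = {l. l < N \<and> v l * v (Suc l) < 0}"
      using False by (auto simp: less_Suc_eq)
    ultimately show ?thesis
      using us by (intro exI[of _ us] exI[of _ e]) auto
  qed
qed

lemma sign_changes_nowhere_zero:
  assumes nz: "\<And>l. v l \<noteq> 0"
  shows "sign_changes UNIV v \<le> ereal (real m) \<longleftrightarrow>
    finite {l. v l * v (Suc l) < 0} \<and> card {l. v l * v (Suc l) < 0} \<le> m"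
proof -
  have "sign_change_pairs UNIV v = (\<lambda>l. (l, Suc l)) ` {l. v l * v (Suc l) < 0}"
    unfolding sign_change_pairs_def
    using nz by (auto simp: image_iff) (metis Suc_lessI lessI)+
  moreover have "inj_on (\<lambda>l. (l, Suc l)) {l. v l * v (Suc l) < 0}" by (auto simp: inj_on_def)
  ultimately show ?thesis
    by (auto simp: sign_changes_def card_image finite_image_iff)
qed

lemma S_plus_gt_imp_weakly_alternating:
  assumes "\<not> S_plus UNIV y \<le> ereal (real m)"
  shows "\<exists>us. sorted_wrt (<) us \<and> length us = Suc (Suc m) \<and> weakly_alternating y us"
proof -
  obtain v where v: "v \<in> zero_replacements UNIV y" "\<not> sign_changes UNIV v \<le> ereal (real m)"
    using assms unfolding S_plus_def by (auto simp: SUP_le_iff)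
  have nz: "v l \<noteq> 0" and y: "y l = 0 \<or> v l = y l" for l
    using v(1) by (auto simp: zero_replacements_def)
  let ?E = "{l. v l * v (Suc l) < 0}"
  have "\<not> (finite ?E \<and> card ?E \<le> m)"
    using v(2) sign_changes_nowhere_zero[of v m] nz by simp
  then obtain B where B: "B \<subseteq> ?E" "finite B" "card B = Suc m"
  proof (cases "finite ?E")
    case True
    then show ?thesis
      using that \<open>\<not> (finite ?E \<and> card ?E \<le> m)\<close> obtain_subset_with_card_n[of "Suc m" ?E] by auto
  next
    case False
    then show ?thesis using that infinite_arbitrarily_large[of ?E "Suc m"] by blast
  qed
  obtain N where N: "B \<subseteq> {..<N}" using finite_nat_bounded[OF B(2)] by auto
  have "Suc m \<le> card {l. l < N \<and> v l * v (Suc l) < 0}"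
    unfolding B(3)[symmetric] using B(1) N by (intro card_mono) auto
  moreover obtain us e where us: "e = 1 \<or> e = -1" "sorted_wrt (<) us"
    "length us = Suc (card {l. l < N \<and> v l * v (Suc l) < 0})"
    "\<And>k. k < length us \<Longrightarrow> e * (-1) ^ k * v (us ! k) > 0"
    using alternating_prefix[of v N] nz by blast
  ultimately have len: "length (take (Suc (Suc m)) us) = Suc (Suc m)" by simp
  have "e * (-1) ^ k * y (us ! k) \<ge> 0" if "k < length us" for k
    using us(4)[OF that] y[of "us ! k"] by auto
  then have "weakly_alternating y (take (Suc (Suc m)) us)"
    unfolding weakly_alternating_def using us(1) by (intro exI[of _ e]) auto
  with len us(2) sorted_wrt_take show ?thesis by blast
qed

text \<open>Replacing the zeros on the alternating list by the signs that the alternation prescribes,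
  and all other zeros by \<open>1\<close>, produces a sign change in each of the \<open>m +
  1\<close> disjoint gaps of the list.\<close>

lemma weakly_alternating_imp_S_plus_gt:
  assumes us: "sorted_wrt (<) us" "length us = Suc (Suc m)" and alt: "weakly_alternating y us"
  shows "\<not> S_plus UNIV y \<le> ereal (real m)"
proof
  assume le: "S_plus UNIV y \<le> ereal (real m)"
  obtain e :: real where e: "e = 1 \<or> e = -1" "\<And>k. k < length us \<Longrightarrow> e * (-1) ^ k * y (us ! k) \<ge> 0"
    using alt by (auto simp: weakly_alternating_def)
  have dist: "distinct us" using us(1) by (simp add: strict_sorted_iff)
  define v where "v l = (if y l \<noteq> 0 then y l
    else if l \<in> set us then e * (-1) ^ (THE k. k < length us \<and> us ! k = l) else 1)" for l
  have nz: "v l \<noteq> 0" for l using e(1) by (auto simp: v_def)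
  have "v \<in> zero_replacements UNIV y" using nz by (auto simp: zero_replacements_def v_def)
  then have "sign_changes UNIV v \<le> ereal (real m)"
    using le unfolding S_plus_def SUP_le_iff by blast
  then have E: "finite {l. v l * v (Suc l) < 0}" "card {l. v l * v (Suc l) < 0} \<le> m"
    using sign_changes_nowhere_zero[of v m] nz by auto
  have pos: "e * (-1) ^ k * v (us ! k) > 0" if k: "k < length us" for k
  proof -
    have "(THE k'. k' < length us \<and> us ! k' = us ! k) = k"
      using k dist by (intro the_equality) (auto simp: nth_eq_iff_index_eq)
    then have "v (us ! k) = (if y (us ! k) \<noteq> 0 then y (us ! k) else e * (-1) ^ k)"
      using k by (simp add: v_def)
    moreover have "e * (-1) ^ k = 1 \<or> e * (-1) ^ k = -1"
      using e(1) by (cases "even k") auto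
    ultimately show ?thesis using e(2)[OF k] by (cases "y (us ! k) = 0") auto
  qed
  have mono: "us ! a < us ! b" if "a < b" "b < length us" for a b
    using us(1) that by (simp add: sorted_wrt_iff_nth_less)
  have "\<exists>l. us ! k \<le> l \<and> l < us ! Suc k \<and> v l * v (Suc l) < 0" if k: "k \<le> m" for k
  proof -
    have "v (us ! k) * v (us ! Suc k) < 0"
      using pos[of k] pos[of "Suc k"] k us(2) by (auto simp: zero_less_mult_iff mult_less_0_iff)
    then show ?thesis
      using sign_change_between[of "us ! k" "us ! Suc k" v] mono[of k "Suc k"] k us(2) nz by fastforce
  qed
  then obtain f where f: "\<And>k. k \<le> m \<Longrightarrow> us ! k \<le> f k \<and> f k < us ! Suc k \<and> v (f k) * v (Suc (f k)) < 0"
    by metis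
  have less: "f a < f b" if "a < b" "b \<le> m" for a b
  proof -
    have "us ! Suc a \<le> us ! b" using mono[of "Suc a" b] that us(2) by (cases "Suc a = b") auto
    then show ?thesis using f[of a] f[of b] that by force
  qed
  have "inj_on f {..m}"
    by (rule linorder_inj_onI) (use less in force)+
  then have "Suc m = card (f ` {..m})" by (simp add: card_image)
  also have "\<dots> \<le> card {l. v l * v (Suc l) < 0}"
    using E(1) f by (intro card_mono) auto
  finally show False using E(2) by simp
qed

text \<open>A sign change is determined by its left end, which is one of the first \<open>n -
  1\<close> indices. Hence the variation bound for \<open>k = n - 1\<close> speaks about all
  nonzero vectors.\<close>

lemma S_minus_le:
  assumes "n \<ge> 1"
  shows "S_minus {..<n} u \<le> ereal (real (n - 1))"
proof -
  let ?S = "sign_change_pairs {..<n} u"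
  have inj: "inj_on fst ?S"
  proof (rule inj_onI)
    fix p q assume pq: "p \<in> ?S" "q \<in> ?S" "fst p = fst q"
    then obtain i j j' where ij: "p = (i, j)" "q = (i, j')" by (cases p, cases q) auto
    have "\<not> j < j'" "\<not> j' < j" using pq(1,2) by (auto simp: ij sign_change_pairs_def)
    then show "p = q" by (simp add: ij)
  qed
  have sub: "fst ` ?S \<subseteq> {..<n - 1}" by (auto simp: sign_change_pairs_def)
  have "finite ?S" using finite_imageD[OF _ inj] finite_subset[OF sub] by simp
  moreover have "card ?S \<le> n - 1"
    using card_mono[OF _ sub] card_image[OF inj] by simp
  moreover have "(-1 :: ereal) \<le> ereal (real (n - 1))" by (simp add: one_ereal_def)
  ultimately show ?thesis by (auto simp: S_minus_def sign_changes_def)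
qed

section \<open>Sign regularity of the column space and positivity of the minors\<close>

lemma sorted_delete:
  assumes "sorted_wrt R us"
  shows "sorted_wrt R (take k us @ drop (Suc k) us)"
proof (cases "k < length us")
  case True
  have "sorted_wrt R (take k us @ us ! k # drop (Suc k) us)"
    using assms id_take_nth_drop[OF True] by simp
  then show ?thesis by (auto simp: sorted_wrt_append)
qed (use assms in simp)

text \<open>In the relation between \<open>n + 1\<close> rows the signs \<open>(-1)\<^sup>k\<close>
  cancel against the alternation of \<open>y\<close>, so a sum of nonnegative terms is zero. Then
  \<open>y\<close> vanishes on the whole list, and an invertible submatrix maps \<open>x\<close>
  to zero.\<close>

theorem positive_minors_imp_not_weakly_alternating:
  assumes pos: "\<And>J. sorted_wrt (<) J \<Longrightarrow> length J = n \<Longrightarrow> rows_minor P J > 0"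
    and x: "j < n" "x j \<noteq> 0" and us: "sorted_wrt (<) us" "length us = Suc n"
  shows "\<not> weakly_alternating (\<lambda>i. \<Sum>j<n. P i j * x j) us"
proof
  define y where "y i = (\<Sum>j<n. P i j * x j)" for i
  assume "weakly_alternating (\<lambda>i. \<Sum>j<n. P i j * x j) us"
  then obtain e :: real where e: "e = 1 \<or> e = -1" "\<And>k. k < length us \<Longrightarrow> e * (-1) ^ k * y (us ! k) \<ge> 0"
    by (auto simp: weakly_alternating_def y_def)
  let ?D = "\<lambda>k. rows_minor P (take k us @ drop (Suc k) us)"
  have D: "?D k > 0" if "k < Suc n" for k
    by (rule pos) (use us that sorted_delete in auto)
  have "(\<Sum>k<Suc n. e * (-1) ^ k * y (us ! k) * ?D k) = e * (\<Sum>k<Suc n. (-1) ^ k * y (us ! k) * ?D k)"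
    unfolding sum_distrib_left by (intro sum.cong refl) (simp only: mult.assoc)
  also have "\<dots> = 0" by (subst rows_minor_relation[OF us(2)]) (simp_all add: y_def)
  finally have "(\<Sum>k<Suc n. e * (-1) ^ k * y (us ! k) * ?D k) = 0" .
  moreover have nonneg: "e * (-1) ^ k * y (us ! k) * ?D k \<ge> 0" if "k \<in> {..<Suc n}" for k
    by (rule mult_nonneg_nonneg) (use e(2)[of k] D[of k] us(2) that in auto)
  ultimately have "\<forall>k\<in>{..<Suc n}. e * (-1) ^ k * y (us ! k) * ?D k = 0"
    by (subst (asm) sum_nonneg_eq_0_iff) (auto simp del: sum.lessThan_Suc)
  then have zero: "y (us ! k) = 0" if "k < Suc n" for k
    using D[OF that] e(1) that by force
  let ?M = "mat n n (\<lambda>(i, j). P (take n us ! i) j)"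
  have M: "?M \<in> carrier_mat n n" by simp
  have "?M *\<^sub>v vec n x = 0\<^sub>v n"
    using zero by (intro eq_vecI) (auto simp: scalar_prod_def y_def atLeast0LessThan)
  moreover have "vec n x \<noteq> 0\<^sub>v n" using x by (auto simp: vec_eq_iff)
  ultimately have "det ?M = 0"
    using det_0_iff_vec_prod_zero_field[OF M] vec_carrier by blast
  moreover have "det ?M > 0"
    using pos[of "take n us"] us by (simp add: rows_minor_def sorted_wrt_take)
  ultimately show False by simp
qed

text \<open>Otherwise the entries are closed under predecessors, hence an initial segment of the
  naturals.\<close>

lemma increasing_list_has_gap:
  assumes J: "sorted_wrt (<) J" "length J = n" "J \<noteq> [0..<n]"
  obtains q where "Suc q \<in> set J" and "q \<notin> set J"
proof -
  have "\<exists>q. Suc q \<in> set J \<and> q \<notin> set J"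
  proof (rule ccontr)
    assume "\<not> ?thesis"
    then have down: "q \<in> set J" if "Suc q \<in> set J" for q using that by blast
    have "i \<in> set J" if "i \<le> j" "j \<in> set J" for i j
      using that by (induction rule: inc_induct) (use down in auto)
    then have "{..j} \<subseteq> set J" if "j \<in> set J" for j using that by auto
    then have "Suc j \<le> n" if "j \<in> set J" for j
      using card_mono[of "set J" "{..j}"] that J(1,2) by (simp add: strict_sorted_iff distinct_card)
    then have "set J \<subseteq> {..<n}" by (auto simp: Suc_le_eq)
    then have "set J = {..<n}"
      using J(1,2) card_subset_eq[of "{..<n}" "set J"] by (simp add: strict_sorted_iff distinct_card)
    then have "J = [0..<n]" using J(1) by (intro strict_sorted_equal) (simp_all add: atLeast0LessThan)
    with J(3) show False ..
  qed
  with that show ?thesis by blast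
qed

text \<open>Induction on the sum of the row indices: a gap of \<open>J\<close> lets one of them be
  lowered from \<open>Suc q\<close> to \<open>q\<close>. With this row index as a variable the
  minor becomes a sequence \<open>y\<close> of the form \<open>P x\<close> that vanishes at the
  remaining rows. It is positive at \<open>q\<close> by induction; if it were not positive at
  \<open>Suc q\<close>, it would weakly alternate along the \<open>n + 1\<close> indices formed by
  \<open>q\<close> and \<open>J\<close>.\<close>

theorem not_weakly_alternating_imp_positive_minors:
  assumes bound: "\<And>x us. \<exists>j<n. x j \<noteq> 0 \<Longrightarrow> sorted_wrt (<) us \<Longrightarrow> length us = Suc n \<Longrightarrow>
      \<not> weakly_alternating (\<lambda>i. \<Sum>j<n. P i j * x j) us"
    and init: "rows_minor P [0..<n] > 0"
    and J: "sorted_wrt (<) J" "length J = n"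
  shows "rows_minor P J > 0"
  using J
proof (induction "sum_list J" arbitrary: J rule: less_induct)
  case less
  show ?case
  proof (cases "J = [0..<n]")
    case False
    obtain q where q: "Suc q \<in> set J" "q \<notin> set J"
      using increasing_list_has_gap[OF less.prems False] .
    obtain L R where J: "J = L @ Suc q # R" using q(1) by (auto simp: in_set_conv_decomp)
    have us: "sorted_wrt (<) (L @ q # Suc q # R)"
      using less.prems(1) q(2) unfolding J by (fastforce simp: sorted_wrt_append less_Suc_eq)
    have len: "length L + length R = n - 1" "n \<ge> 1" using less.prems(2) J by auto
    define y where "y i = rows_minor P (L @ i # R)" for i
    have yq: "y q > 0"
      unfolding y_def by (rule less.hyps) (use us J less.prems in \<open>auto simp: sorted_wrt_append\<close>)
    have zero: "y i = 0" if "i \<in> set L \<union> set R" for i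
      unfolding y_def using that by (intro rows_minor_repeated_row) auto
    obtain x where x: "y i = (\<Sum>j<n. P i j * x j)" for i
      by (rule rows_minor_row_linear[of P L R]) (use len in \<open>auto simp: y_def\<close>)
    have "\<exists>j<n. x j \<noteq> 0"
    proof (rule ccontr)
      assume "\<not> ?thesis"
      then have "y q = 0" by (simp add: x)
      with yq show False by simp
    qed
    then have na: "\<not> weakly_alternating y (L @ q # Suc q # R)"
      using bound[OF _ us, of x] len unfolding x[abs_def] by simp
    have "y (Suc q) > 0"
    proof (rule ccontr)
      assume "\<not> y (Suc q) > 0"
      let ?l = "length L" and ?us = "L @ q # Suc q # R"
      \<comment> \<open>the factor \<open>(-1) ^ ?l\<close> makes the sign at the position of \<open>q\<close> positive\<close>
      have "(-1) ^ ?l * (-1) ^ k * y (?us ! k) \<ge> 0" if k: "k < length ?us" for k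
      proof -
        consider "k < ?l" | "k = ?l" | "k = Suc ?l" | "Suc ?l < k" by linarith
        then show ?thesis
        proof cases
          case 1
          then show ?thesis using zero[of "?us ! k"] by (simp add: nth_append)
        next
          case 2
          then show ?thesis using yq by (simp add: minus_one_power_iff)
        next
          case 3
          then show ?thesis using \<open>\<not> y (Suc q) > 0\<close> by (simp add: nth_append minus_one_power_iff)
        next
          case 4
          then have "?us ! k \<in> set R" using k by (auto simp: nth_append nth_Cons')
          then show ?thesis using zero[of "?us ! k"] by simp
        qed
      qed
      moreover have "(-1 :: real) ^ ?l = 1 \<or> (-1 :: real) ^ ?l = -1" by (simp add: minus_one_power_iff)
      ultimately show False using na unfolding weakly_alternating_def by blast
    qed
    then show ?thesis by (simp add: y_def J)
  qed (use init in simp)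
qed

section \<open>The observability operator in normalized coordinates\<close>

lemma stacked_rows_mult:
  assumes "\<And>i. i < r \<Longrightarrow> Y i \<in> carrier_mat 1 n" and "M \<in> carrier_mat n m"
  shows "mat r n (\<lambda>(i, j). Y i $$ (0, j)) * M = mat r m (\<lambda>(i, j). (Y i * M) $$ (0, j))"
proof (rule eq_matI)
  fix i j assume "i < dim_row (mat r m (\<lambda>(i, j). (Y i * M) $$ (0, j)))"
    and "j < dim_col (mat r m (\<lambda>(i, j). (Y i * M) $$ (0, j)))"
  then have ij: "i < r" "j < m" by auto
  then show "(mat r n (\<lambda>(i, j). Y i $$ (0, j)) * M) $$ (i, j) = mat r m (\<lambda>(i, j). (Y i * M) $$ (0, j)) $$ (i, j)"
    using assms(1)[OF ij(1)] assms(2) by (simp add: scalar_prod_def)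
qed (use assms(2) in auto)

lemma pow_mat_add:
  assumes A: "A \<in> carrier_mat n n"
  shows "A ^\<^sub>m (s + t) = A ^\<^sub>m s * A ^\<^sub>m t"
proof (induction t)
  case 0
  then show ?case using A pow_carrier_mat[OF A, of s] by simp
next
  case (Suc t)
  then show ?case
    using assoc_mult_mat[OF pow_carrier_mat[OF A, of s] pow_carrier_mat[OF A, of t] A] by simp
qed

text \<open>The matrix is block lower triangular with an identity block in the upper left corner.\<close>

lemma rows_minor_identity_prefix:
  assumes unit: "\<And>i j. i < k \<Longrightarrow> P i j = (if i = j then 1 else 0)"
  shows "rows_minor P ([0..<k] @ [s..<s + r]) = det (mat r r (\<lambda>(i, j). P (s + i) (k + j)))"
proof -
  let ?B = "mat r r (\<lambda>(i, j). P (s + i) (k + j))"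
  let ?F = "four_block_mat (1\<^sub>m k) (0\<^sub>m k r) (mat r k (\<lambda>(i, j). P (s + i) j)) ?B"
  have "mat (k + r) (k + r) (\<lambda>(i, j). P (([0..<k] @ [s..<s + r]) ! i) j) = ?F"
    by (rule eq_matI) (auto simp: nth_append unit)
  then have "rows_minor P ([0..<k] @ [s..<s + r]) = det ?F" by (simp add: rows_minor_def)
  also have "\<dots> = det (1\<^sub>m k) * det ?B"
    by (rule det_four_block_mat_upper_right_zero) auto
  finally show ?thesis by simp
qed

lemma mult_last_columns_selector:
  assumes M: "M \<in> carrier_mat p (k + r)"
  shows "M * (0\<^sub>m k r @\<^sub>r 1\<^sub>m r) = mat p r (\<lambda>(i, j). (M $$ (i, k + j) :: real))"
proof (rule eq_matI)
  have E: "0\<^sub>m k r @\<^sub>r 1\<^sub>m r = mat (k + r) r (\<lambda>(i, j). if i = k + j then 1 else (0 :: real))"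
    by (rule eq_matI) (auto simp: append_rows_def)
  fix i j assume "i < dim_row (mat p r (\<lambda>(i, j). M $$ (i, k + j)))"
    and "j < dim_col (mat p r (\<lambda>(i, j). M $$ (i, k + j)))"
  then have ij: "i < p" "j < r" by auto
  have "(M * (0\<^sub>m k r @\<^sub>r 1\<^sub>m r)) $$ (i, j)
      = (\<Sum>l\<in>{0..<k + r}. M $$ (i, l) * (if l = k + j then 1 else 0))"
    unfolding E using ij M by (auto simp: scalar_prod_def intro!: sum.cong)
  also have "\<dots> = M $$ (i, k + j)" using ij by (simp add: if_distrib cong: if_cong)
  finally show "(M * (0\<^sub>m k r @\<^sub>r 1\<^sub>m r)) $$ (i, j) = mat p r (\<lambda>(i, j). M $$ (i, k + j)) $$ (i, j)"
    using ij by simp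
qed (use M in \<open>auto simp: append_rows_def\<close>)

locale observable_pair =
  fixes n :: nat and A c :: "real mat"
  assumes A: "A \<in> carrier_mat n n" and c: "c \<in> carrier_mat 1 n" and obs: "observable A c"
begin

abbreviation "Ob \<equiv> observability_mat A c n"

definition inverse_Ob where "inverse_Ob = the (mat_inverse Ob)"

text \<open>The entries of \<open>P = \<O> (\<O>\<^sup>n)\<inverse>\<close>, with the default value
  \<open>0\<close> outside the first \<open>n\<close> columns.\<close>

definition normalized :: "nat \<Rightarrow> nat \<Rightarrow> real" where
  "normalized t j = (if j < n then (c * A ^\<^sub>m t * inverse_Ob) $$ (0, j) else 0)"

lemma cA: "c * A ^\<^sub>m t \<in> carrier_mat 1 n"
  using c pow_carrier_mat[OF A] by (rule mult_carrier_mat)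

lemma observability_mat_carrier: "observability_mat A c r \<in> carrier_mat r n"
  using A by (simp add: observability_mat_def)

lemma inverse_Ob: "inverse_Ob \<in> carrier_mat n n" "Ob * inverse_Ob = 1\<^sub>m n" "inverse_Ob * Ob = 1\<^sub>m n"
proof -
  obtain B where B: "Ob * B = 1\<^sub>m n" "B * Ob = 1\<^sub>m (dim_row B)"
    using obs A observability_mat_carrier[of n]
    by (auto simp: observable_def invertible_mat_def inverts_mat_def)
  have "dim_row B = n" "dim_col B = n"
    using arg_cong[OF B(1), of dim_col] arg_cong[OF B(2), of dim_col] observability_mat_carrier[of n]
    by auto
  then have "Ob \<in> Units (ring_mat TYPE(real) n ())"
    using B observability_mat_carrier[of n] unfolding Units_def ring_mat_def by auto
  then obtain B' where "mat_inverse Ob = Some B'"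
    using mat_inverse(1)[OF observability_mat_carrier[of n], of "()"] by fastforce
  with mat_inverse(2)[OF observability_mat_carrier[of n] this]
  show "inverse_Ob \<in> carrier_mat n n" "Ob * inverse_Ob = 1\<^sub>m n" "inverse_Ob * Ob = 1\<^sub>m n" by (auto simp: inverse_Ob_def)
qed

lemma observability_mat_mult_pow_mult_inverse_Ob:
  "observability_mat A c r * A ^\<^sub>m s * inverse_Ob = mat r n (\<lambda>(i, j). normalized (i + s) j)"
proof -
  have "observability_mat A c r * A ^\<^sub>m s = mat r n (\<lambda>(i, j). (c * A ^\<^sub>m (i + s)) $$ (0, j))"
    using A assoc_mult_mat[OF c pow_carrier_mat[OF A] pow_carrier_mat[OF A]]
      stacked_rows_mult[of r "\<lambda>i. c * A ^\<^sub>m i", OF cA pow_carrier_mat[OF A, of s]]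
    by (simp add: observability_mat_def pow_mat_add[OF A])
  then have "observability_mat A c r * A ^\<^sub>m s * inverse_Ob
      = mat r n (\<lambda>(i, j). (c * A ^\<^sub>m (i + s) * inverse_Ob) $$ (0, j))"
    using stacked_rows_mult[of r "\<lambda>i. c * A ^\<^sub>m (i + s)", OF cA inverse_Ob(1)] by simp
  also have "\<dots> = mat r n (\<lambda>(i, j). normalized (i + s) j)"
    by (rule eq_matI) (auto simp: normalized_def)
  finally show ?thesis .
qed

lemma normalized_unit:
  assumes "i < n"
  shows "normalized i j = (if i = j then 1 else 0)"
proof (cases "j < n")
  case True
  have "normalized i j = mat n n (\<lambda>(i, j). normalized (i + 0) j) $$ (i, j)" using assms True by simp
  also have "\<dots> = (Ob * A ^\<^sub>m 0 * inverse_Ob) $$ (i, j)"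
    by (simp only: observability_mat_mult_pow_mult_inverse_Ob)
  also have "Ob * A ^\<^sub>m 0 * inverse_Ob = 1\<^sub>m n"
    using A inverse_Ob observability_mat_carrier[of n] by simp
  finally show ?thesis using assms True by simp
qed (use assms in \<open>simp add: normalized_def\<close>)

lemma observability_op_normalized:
  assumes u: "u \<in> carrier_vec n"
  shows "observability_op A c u t = (\<Sum>j<n. normalized t j * (Ob *\<^sub>v u) $ j)"
proof -
  have "c * A ^\<^sub>m t = c * A ^\<^sub>m t * inverse_Ob * Ob"
    using assoc_mult_mat[OF cA[of t] inverse_Ob(1) observability_mat_carrier[of n]] right_mult_one_mat[OF cA[of t]]
    by (simp add: inverse_Ob(3))
  then have "(c * A ^\<^sub>m t) *\<^sub>v u = (c * A ^\<^sub>m t * inverse_Ob) *\<^sub>v (Ob *\<^sub>v u)"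
    using assoc_mult_mat_vec[OF mult_carrier_mat[OF cA[of t] inverse_Ob(1)] observability_mat_carrier[of n] u]
    by simp
  moreover have "(W *\<^sub>v w) $ 0 = (\<Sum>j<n. W $$ (0, j) * w $ j)"
    if "W \<in> carrier_mat 1 n" "w \<in> carrier_vec n" for W and w :: "real vec"
    using that by (simp add: scalar_prod_def atLeast0LessThan)
  note this[OF mult_carrier_mat[OF cA[of t] inverse_Ob(1)] mult_mat_vec_carrier[OF observability_mat_carrier[of n] u]]
  ultimately show ?thesis by (simp only: observability_op_def normalized_def) simp
qed

text \<open>Multiplicativity collapses the product of compounds to the \<open>r\<close>-th compound of
  \<open>\<O>\<^sup>r A\<^sup>t A\<^sup>n\<^sup>-\<^sup>r (\<O>\<^sup>n)\<inverse> E\<close>, an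
  \<open>r \<times> r\<close> matrix, where \<open>E\<close> selects the last \<open>r\<close>
  columns. Its compound is its determinant, and its rows are the rows \<open>t + n - r, t + n - r
  + 1, \<dots>\<close> of \<open>P\<close> restricted to these columns.\<close>

lemma strictly_externally_positive_iff:
  assumes r: "r \<le> n"
  shows "strictly_externally_positive (compound_A A r) (compound_b A c r) (compound_c A c r) \<longleftrightarrow>
    (\<forall>s\<ge>n - r. rows_minor normalized ([0..<n - r] @ [s..<s + r]) > 0)"
proof -
  define E where "E = (0\<^sub>m (n - r) r @\<^sub>r 1\<^sub>m r :: real mat)"
  define X where "X = A ^\<^sub>m (n - r) * inverse_Ob * E"
  define K where "K = observability_mat A c r"
  have E: "E \<in> carrier_mat n r" using r by (auto simp: E_def append_rows_def)
  have X: "X \<in> carrier_mat n r" unfolding X_def using A inverse_Ob(1) E by (meson mult_carrier_mat pow_carrier_mat)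
  have K: "K \<in> carrier_mat r n" unfolding K_def by (rule observability_mat_carrier)
  have b: "compound_b A c r = compound_mat r X"
    using A by (simp add: compound_b_def X_def inverse_Ob_def E_def)
  have gain: "(compound_c A c r * compound_A A r ^\<^sub>m t * compound_b A c r) $$ (0, 0)
      = rows_minor normalized ([0..<n - r] @ [t + (n - r)..<t + (n - r) + r])" for t
  proof -
    have At: "A ^\<^sub>m s \<in> carrier_mat n n" for s using A by (rule pow_carrier_mat)
    have KA: "K * A ^\<^sub>m t \<in> carrier_mat r n" using K At by (rule mult_carrier_mat)
    have "compound_c A c r * compound_A A r ^\<^sub>m t * compound_b A c r = compound_mat r (K * A ^\<^sub>m t * X)"
      unfolding b compound_c_def compound_A_def K_def[symmetric] compound_mat_mult_pow[OF K A]
      by (rule compound_mat_mult[OF KA X, symmetric])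
    also have "K * A ^\<^sub>m t * X = K * A ^\<^sub>m t * (A ^\<^sub>m (n - r) * inverse_Ob) * E"
      unfolding X_def by (rule assoc_mult_mat[symmetric, OF KA mult_carrier_mat[OF At inverse_Ob(1)] E])
    also have "K * A ^\<^sub>m t * (A ^\<^sub>m (n - r) * inverse_Ob) = K * A ^\<^sub>m t * A ^\<^sub>m (n - r) * inverse_Ob"
      by (rule assoc_mult_mat[symmetric, OF KA At inverse_Ob(1)])
    also have "K * A ^\<^sub>m t * A ^\<^sub>m (n - r) = K * A ^\<^sub>m (t + (n - r))"
      unfolding pow_mat_add[OF A] by (rule assoc_mult_mat[OF K At At])
    also have "K * A ^\<^sub>m (t + (n - r)) * inverse_Ob * E
        = mat r r (\<lambda>(i, j). normalized (t + (n - r) + i) (n - r + j))"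
      using r mult_last_columns_selector[of "mat r n (\<lambda>(i, j). normalized (i + (t + (n - r))) j)" r "n - r" r]
      unfolding K_def E_def observability_mat_mult_pow_mult_inverse_Ob by (auto simp: add_ac intro!: eq_matI)
    finally show ?thesis
      using rows_minor_identity_prefix[of "n - r" normalized "t + (n - r)" r] normalized_unit
      by (simp add: compound_mat_full)
  qed
  have "compound_A A r \<in> carrier_mat (dim_row (compound_A A r)) (dim_row (compound_A A r))"
    "compound_b A c r \<in> carrier_mat (dim_row (compound_A A r)) 1"
    "compound_c A c r \<in> carrier_mat 1 (dim_row (compound_A A r))"
    unfolding b compound_A_def compound_c_def K_def[symmetric]
    by (rule carrier_matI; simp add: carrier_matD[OF A] carrier_matD[OF X] carrier_matD[OF K] index_sets_full)+
  then have "strictly_externally_positive (compound_A A r) (compound_b A c r) (compound_c A c r) \<longleftrightarrow>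
    (\<forall>t\<ge>1. rows_minor normalized ([0..<n - r] @ [t - 1 + (n - r)..<t - 1 + (n - r) + r]) > 0)"
    by (simp only: strictly_externally_positive_def gain simp_thms)
  also have "\<dots> \<longleftrightarrow> (\<forall>s\<ge>n - r. rows_minor normalized ([0..<n - r] @ [s..<s + r]) > 0)"
  proof safe
    fix s assume *: "\<forall>t\<ge>1. rows_minor normalized ([0..<n - r] @ [t - 1 + (n - r)..<t - 1 + (n - r) + r]) > 0"
      and "n - r \<le> s"
    then show "rows_minor normalized ([0..<n - r] @ [s..<s + r]) > 0"
      using *[rule_format, of "Suc (s - (n - r))"] by simp
  next
    fix t :: nat assume *: "\<forall>s\<ge>n - r. rows_minor normalized ([0..<n - r] @ [s..<s + r]) > 0"
    show "rows_minor normalized ([0..<n - r] @ [t - 1 + (n - r)..<t - 1 + (n - r) + r]) > 0"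
      by (rule *[rule_format]) simp
  qed
  finally show ?thesis .
qed

text \<open>The change of variables \<open>x = \<O>\<^sup>n u\<close> is a bijection that preserves
  being nonzero.\<close>

lemma strictly_variation_bounding_iff:
  assumes n: "n \<ge> 1"
  shows "strictly_variation_bounding (n - 1) n (observability_op A c) \<longleftrightarrow>
    (\<forall>x us. (\<exists>j<n. x j \<noteq> 0) \<longrightarrow> sorted_wrt (<) us \<longrightarrow> length us = Suc n \<longrightarrow>
      \<not> weakly_alternating (\<lambda>i. \<Sum>j<n. normalized i j * x j) us)" (is "?L \<longleftrightarrow> ?R")
proof -
  have bound_iff: "S_plus UNIV y \<le> ereal (real (n - 1)) \<longleftrightarrow>
      (\<forall>us. sorted_wrt (<) us \<longrightarrow> length us = Suc n \<longrightarrow> \<not> weakly_alternating y us)" for y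
    using S_plus_gt_imp_weakly_alternating[of y "n - 1"]
      weakly_alternating_imp_S_plus_gt[of _ "n - 1" y] n by auto
  have op: "observability_op A c u = (\<lambda>t. \<Sum>j<n. normalized t j * (Ob *\<^sub>v u) $ j)"
    if "u \<in> carrier_vec n" for u
    using observability_op_normalized[OF that] by auto
  show ?thesis
  proof
    assume L: ?L
    show ?R
    proof (intro allI impI)
      fix x :: "nat \<Rightarrow> real" and us :: "nat list"
      assume x: "\<exists>j<n. x j \<noteq> 0" and us: "sorted_wrt (<) us" "length us = Suc n"
      define u where "u = inverse_Ob *\<^sub>v vec n x"
      have u: "u \<in> carrier_vec n" using inverse_Ob(1) by (simp add: u_def)
      have Obu: "Ob *\<^sub>v u = vec n x"
        using assoc_mult_mat_vec[OF observability_mat_carrier[of n] inverse_Ob(1), of "vec n x"] inverse_Ob(2)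
        by (simp add: u_def)
      have "u \<noteq> 0\<^sub>v n"
      proof
        assume "u = 0\<^sub>v n"
        moreover have "Ob *\<^sub>v 0\<^sub>v n = 0\<^sub>v n"
          using observability_mat_carrier[of n] by (intro eq_vecI) auto
        ultimately have "vec n x = 0\<^sub>v n" using Obu by simp
        with x show False by (auto simp: vec_eq_iff)
      qed
      have opu: "observability_op A c u = (\<lambda>t. \<Sum>j<n. normalized t j * x j)"
        by (simp add: op[OF u] Obu)
      have "S_plus UNIV (observability_op A c u) \<le> ereal (real (n - 1))"
        using \<open>u \<noteq> 0\<^sub>v n\<close> L u S_minus_le[OF n] by (simp add: strictly_variation_bounding_def)
      then show "\<not> weakly_alternating (\<lambda>i. \<Sum>j<n. normalized i j * x j) us"
        using us unfolding opu bound_iff by blast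
    qed
  next
    assume R: ?R
    show ?L unfolding strictly_variation_bounding_def
    proof (intro ballI impI)
      fix u assume u: "u \<in> carrier_vec n" and "u \<noteq> 0\<^sub>v n \<and> S_minus {..<n} (($) u) \<le> ereal (real (n - 1))"
      then have u0: "u \<noteq> 0\<^sub>v n" by simp
      have Obu: "Ob *\<^sub>v u \<in> carrier_vec n"
        using observability_mat_carrier[of n] u by (rule mult_mat_vec_carrier)
      have "\<exists>j<n. (Ob *\<^sub>v u) $ j \<noteq> 0"
      proof (rule ccontr)
        assume "\<not> ?thesis"
        then have "Ob *\<^sub>v u = 0\<^sub>v n" using carrier_vecD[OF Obu] by (intro eq_vecI) simp_all
        moreover have "inverse_Ob *\<^sub>v (Ob *\<^sub>v u) = u"
          using assoc_mult_mat_vec[OF inverse_Ob(1) observability_mat_carrier[of n] u] inverse_Ob(3) u by simp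
        moreover have "inverse_Ob *\<^sub>v 0\<^sub>v n = 0\<^sub>v n" using inverse_Ob(1) by (intro eq_vecI) auto
        ultimately show False using u0 by simp
      qed
      then show "S_plus UNIV (observability_op A c u) \<le> ereal (real (n - 1))"
        using R unfolding op[OF u] bound_iff by blast
    qed
  qed
qed

lemma positive_minors_iff_initial:
  "(\<forall>J. sorted_wrt (<) J \<longrightarrow> length J = n \<longrightarrow> rows_minor normalized J > 0) \<longleftrightarrow>
    (\<forall>r\<in>{1..n}. \<forall>s\<ge>n - r. rows_minor normalized ([0..<n - r] @ [s..<s + r]) > 0)" (is "?L \<longleftrightarrow> ?R")
proof
  assume L: ?L
  show ?R
  proof (intro ballI allI impI)
    fix r s assume "r \<in> {1..n}" "n - r \<le> s"
    then show "rows_minor normalized ([0..<n - r] @ [s..<s + r]) > 0"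
      by (intro L[rule_format]) (auto simp: sorted_wrt_append)
  qed
next
  assume R: ?R
  show ?L
  proof (intro allI impI)
    fix J :: "nat list" assume J: "sorted_wrt (<) J" "length J = n"
    show "rows_minor normalized J > 0"
    proof (rule fekete_criterion[OF _ J])
      fix k s assume ks: "k \<le> n" "k \<le> s"
      show "rows_minor normalized ([0..<k] @ [s..<s + (n - k)]) > 0"
      proof (cases "k = n")
        case True
        then show ?thesis
          using rows_minor_identity_prefix[of n normalized s 0] normalized_unit by simp
      next
        case False
        then show ?thesis using R[rule_format, of "n - k" s] ks by simp
      qed
    qed
  qed
qed

lemma strictly_variation_bounding_iff_positive_minors:
  assumes n: "n \<ge> 1"
  shows "strictly_variation_bounding (n - 1) n (observability_op A c) \<longleftrightarrow>
    (\<forall>J. sorted_wrt (<) J \<longrightarrow> length J = n \<longrightarrow> rows_minor normalized J > 0)"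
    (is "_ \<longleftrightarrow> ?positive")
  unfolding strictly_variation_bounding_iff[OF n]
proof
  assume *: "\<forall>x us. (\<exists>j<n. x j \<noteq> 0) \<longrightarrow> sorted_wrt (<) us \<longrightarrow> length us = Suc n \<longrightarrow>
      \<not> weakly_alternating (\<lambda>i. \<Sum>j<n. normalized i j * x j) us"
  have "rows_minor normalized [0..<n] > 0"
    using rows_minor_identity_prefix[of n normalized 0 0] normalized_unit by simp
  with * show ?positive
    using not_weakly_alternating_imp_positive_minors[of n normalized] by blast
next
  assume ?positive
  then show "\<forall>x us. (\<exists>j<n. x j \<noteq> 0) \<longrightarrow> sorted_wrt (<) us \<longrightarrow> length us = Suc n \<longrightarrow>
      \<not> weakly_alternating (\<lambda>i. \<Sum>j<n. normalized i j * x j) us"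
    using positive_minors_imp_not_weakly_alternating[of n normalized] by blast
qed

end

section \<open>Variation bounds and external positivity\<close>

theorem theorem1:
  fixes n :: nat and A c :: "real mat"
  assumes "n \<ge> 1"
    and "A \<in> carrier_mat n n"
    and "c \<in> carrier_mat 1 n"
    and "observable A c"
  shows "strictly_variation_bounding (n - 1) n (observability_op A c) \<longleftrightarrow>
    (\<forall>r \<in> {1..n}.
       strictly_externally_positive (compound_A A r) (compound_b A c r) (compound_c A c r))"
proof -
  interpret observable_pair n A c by unfold_locales fact+
  show ?thesis
    unfolding strictly_variation_bounding_iff_positive_minors[OF assms(1)] positive_minors_iff_initial
    by (intro ball_cong refl strictly_externally_positive_iff[symmetric]) simp
qed

end
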